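(* Let $\beta\in[0,1]$. If $f\in\mathcal{A}_\beta$ has the form $f(z)=z+\sum_{n=2}^\infty a_n z^n$, then $$T_{3,1}(f)\ge 1-\frac{4\beta-9}{\beta^4-4\beta^3+2\beta^2+8\beta-8}.$$ The bound is sharp.
   Context: $\mathbb{D}=\{z\in\mathbb{C}:|z|<1\}$. $\mathcal{A}$ is the class of holomorphic functions $f$ on $\mathbb{D}$ of the form $f(z)=z+\sum_{n=2}^\infty a_n z^n$. For $\beta\in[0,1]$, $\mathcal{A}_\beta=\{f\in\mathcal{A}:\operatorname{Re}(\beta \frac{f(z)}{z}+(1-\beta)f'(z))>0 \text{ for all } z\in\mathbb{D}\}$, where $f(z)/z$ takes the value $1$ at $z=0$. The third order Hermitian-Toeplitz determinant is $T_{3,1}(f)=\begin{vmatrix}1&a_2&a_3\\ \overline{a_2}&1&a_2\\ \overline{a_3}&\overline{a_2}&1\end{vmatrix}=1-2|a_2|^2+2\operatorname{Re}(a_2^2\overline{a_3})-|a_3|^2$. A bound being sharp means that equality is attained for some $f\in\mathcal{A}_\beta$. *)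

theory Defs
  imports "HOL-Complex_Analysis.Complex_Analysis"
begin

abbreviation unit_disc :: "complex set" where
  "unit_disc \<equiv> ball 0 1"

definition class_A :: "(complex \<Rightarrow> complex) set" where
  "class_A = {f. f holomorphic_on unit_disc \<and>
     (\<exists>a :: nat \<Rightarrow> complex. \<forall>z\<in>unit_disc. (\<lambda>n. a (n + 2) * z ^ (n + 2)) sums (f z - z))}"

text \<open>The quotient \<open>f z / z\<close> is given its limit value \<open>1\<close> at \<open>0\<close>, where Isabelle's
  division would yield \<open>0\<close>.\<close>

definition class_A_beta :: "real \<Rightarrow> (complex \<Rightarrow> complex) set" where
  "class_A_beta \<beta> = {f \<in> class_A. \<forall>z\<in>unit_disc.
     Re (of_real \<beta> * (if z = 0 then 1 else f z / z) + of_real (1 - \<beta>) * deriv f z) > 0}"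

definition a_coeff :: "(complex \<Rightarrow> complex) \<Rightarrow> nat \<Rightarrow> complex" where
  "a_coeff f n = fps_nth (fps_expansion f 0) n"

text \<open>For \<open>f \<in> class_A\<close> these are the coefficients \<open>a\<^sub>n\<close> of any representation
  \<open>f z = z + (\<Sum>n\<ge>2. a\<^sub>n z\<^sup>n)\<close> on the disc.\<close>

lemma a_coeff_eq:
  assumes "\<And>z. z \<in> unit_disc \<Longrightarrow> (\<lambda>n. a (n + 2) * z ^ (n + 2)) sums (f z - z)"
  shows "a_coeff f 0 = 0" and "a_coeff f 1 = 1" and "n \<ge> 2 \<Longrightarrow> a_coeff f n = a n"
proof -
  define b where "b n = (if n = 0 then 0 else if n = 1 then 1 else a n)" for n
  have sums: "(\<lambda>n. b n * z ^ n) sums f z" if "z \<in> unit_disc" for z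
  proof -
    have "(\<lambda>n. b (n + 2) * z ^ (n + 2)) sums (f z - (\<Sum>i<2. b i * z ^ i))"
      using assms[OF that] by (simp add: b_def numeral_2_eq_2)
    thus ?thesis
      using sums_iff_shift[of "\<lambda>n. b n * z ^ n" 2] by simp
  qed
  have "f has_fps_expansion Abs_fps b"
    by (rule has_fps_expansionI, rule eventually_nhds_in_open[THEN eventually_mono, of "unit_disc"])
       (use sums in auto)
  hence "fps_expansion f 0 = Abs_fps b"
    by (rule fps_expansion_eqI)
  hence "a_coeff f n = b n" for n
    by (simp add: a_coeff_def)
  thus "a_coeff f 0 = 0" "a_coeff f 1 = 1" "n \<ge> 2 \<Longrightarrow> a_coeff f n = a n"
    by (auto simp: b_def)
qed

definition HT_matrix3 :: "(complex \<Rightarrow> complex) \<Rightarrow> complex ^ 3 ^ 3" where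
  "HT_matrix3 f = vector
     [vector [1, a_coeff f 2, a_coeff f 3],
      vector [cnj (a_coeff f 2), 1, a_coeff f 2],
      vector [cnj (a_coeff f 3), cnj (a_coeff f 2), 1]]"

text \<open>The determinant is real because the matrix is Hermitian, so nothing is lost by taking
  the real part.\<close>

definition T31 :: "(complex \<Rightarrow> complex) \<Rightarrow> real" where
  "T31 f = Re (det (HT_matrix3 f))"

lemma T31_eq:
  "T31 f = 1 - 2 * (cmod (a_coeff f 2))\<^sup>2
     + 2 * Re ((a_coeff f 2)\<^sup>2 * cnj (a_coeff f 3)) - (cmod (a_coeff f 3))\<^sup>2"
  unfolding cmod_power2
  by (simp add: T31_def HT_matrix3_def det_3 power2_eq_square algebra_simps)

lemma of_real_T31: "complex_of_real (T31 f) = det (HT_matrix3 f)"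
  by (simp add: T31_def HT_matrix3_def det_3 complex_eq_iff algebra_simps)

end

theory Submission
  imports Defs
begin

text \<open>
  Write \<open>u = 1 - \<beta>\<close>. For \<open>f\<close> in the class, the function
  \<open>p(z) = \<beta> f(z)/z + (1 - \<beta>) f'(z)\<close> has positive real part and \<open>p(0) = 1\<close>, and its
  coefficients are \<open>c\<^sub>n = (1 + n u) a\<^sub>n\<^sub>+\<^sub>1\<close>; conversely every such \<open>p\<close> comes from some \<open>f\<close>
  (\<open>class_A_betaD\<close>, \<open>class_A_betaI\<close>). So the question only concerns the pairs
  \<open>(c\<^sub>1, c\<^sub>2)\<close> of such functions, and these satisfy
  \<open>\<bar>c\<^sub>2 - c\<^sub>1\<^sup>2/2\<bar> \<le> 2 - \<bar>c\<^sub>1\<bar>\<^sup>2/2\<close> (\<open>caratheodory_second_coefficient\<close>).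

  The determinant can be written as \<open>(1 - X)\<^sup>2 - \<bar>a\<^sub>3 - a\<^sub>2\<^sup>2\<bar>\<^sup>2\<close> with \<open>X = \<bar>a\<^sub>2\<bar>\<^sup>2\<close>
  (\<open>T31_complete_square\<close>). The coefficient inequality becomes
  \<open>\<bar>a\<^sub>3 - a\<^sub>2\<^sup>2\<bar> \<le> (2 - u\<^sup>2 X) / (1 + 2 u)\<close> (\<open>norm_a3_minus_a2_square_le\<close>), whence the
  determinant is at least a quadratic polynomial in \<open>X\<close> with positive leading coefficient. Its
  minimum over all real \<open>X\<close> is the claimed bound, taken at a point \<open>x\<close> (\<open>quadratic_min\<close>).

  For sharpness, equality must hold in the coefficient inequality and in the triangle inequality
  behind the bound for \<open>\<bar>a\<^sub>3 - a\<^sub>2\<^sup>2\<bar>\<close>, and \<open>X\<close> must be \<open>x\<close>. The functions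
  \<open>p(z) = 1 + 2 \<Sum> cos(n \<theta>) z\<^sup>n\<close> have positive real part (\<open>cosine_series\<close>), with
  \<open>c\<^sub>1 = 2 cos \<theta>\<close> and \<open>c\<^sub>2 = c\<^sub>1\<^sup>2 - 2\<close>. Here \<open>c\<^sub>2 - c\<^sub>1\<^sup>2/2 = -(2 - c\<^sub>1\<^sup>2/2)\<close> is real, and
  its sign is the one that makes the triangle inequality for \<open>a\<^sub>3 - a\<^sub>2\<^sup>2\<close> an equality. It
  remains to choose \<open>\<theta>\<close> with \<open>2 cos \<theta> = (1 + u) \<surd>x\<close>, which is possible because the
  right-hand side is at most \<open>2\<close>.
\<close>

section \<open>Coefficients of functions with positive real part\<close>

text \<open>Composing \<open>h\<close> with the disc automorphism that sends \<open>h 0\<close> to \<open>0\<close> reduces this to the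
  derivative bound in the Schwarz lemma; the automorphism has derivative
  \<open>1 / (1 - \<bar>h 0\<bar>\<^sup>2)\<close> at \<open>h 0\<close>.\<close>

lemma schwarz_pick_at_0_strict:
  assumes holo: "h holomorphic_on ball 0 1"
    and bound: "\<And>z. norm z < 1 \<Longrightarrow> norm (h z) < 1"
  shows "norm (deriv h 0) \<le> 1 - (norm (h 0))\<^sup>2"
proof -
  define a where "a = h 0"
  define k where "k = (\<lambda>z. Moebius_function 0 a (h z))"
  have a: "norm a < 1"
    using bound[of 0] by (simp add: a_def)
  have "k holomorphic_on ball 0 1"
    using holomorphic_on_compose_gen[OF holo Moebius_function_holomorphic[OF a, of 0]] bound
    by (auto simp: k_def o_def image_subset_iff)
  moreover have "k 0 = 0"
    by (simp add: k_def a_def Moebius_function_eq_zero)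
  moreover have "norm (k z) < 1" if "norm z < 1" for z
    using Moebius_function_norm_lt_1[OF a bound[OF that]] by (simp add: k_def)
  ultimately have k: "norm (deriv k 0) \<le> 1"
    by (rule Schwarz_Lemma(2)[where \<xi> = 0]) auto
  have aa: "cnj a * a = of_real ((norm a)\<^sup>2)"
    by (simp add: complex_norm_square[symmetric] mult.commute)
  have lt: "(norm a)\<^sup>2 < 1"
    using a by (simp add: power_less_one_iff)
  hence ne: "1 - cnj a * a \<noteq> 0"
    unfolding aa by (metis less_irrefl of_real_eq_1_iff right_minus_eq)
  have "(h has_field_derivative deriv h 0) (at 0)"
    using holo by (auto intro!: holomorphic_derivI)
  hence "(k has_field_derivative
      (deriv h 0 * (1 - cnj a * h 0) + (h 0 - a) * (cnj a * deriv h 0)) / (1 - cnj a * h 0)\<^sup>2) (at 0)"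
    unfolding k_def Moebius_function_simple using ne
    by (auto intro!: derivative_eq_intros simp: a_def power2_eq_square)
  hence "deriv k 0 = deriv h 0 / (1 - cnj a * a)"
    using ne by (simp add: DERIV_imp_deriv a_def power2_eq_square)
  also have "norm \<dots> = norm (deriv h 0) / (1 - (norm a)\<^sup>2)"
    using lt unfolding aa norm_divide
    by (metis abs_of_pos diff_gt_0_iff_gt norm_of_real of_real_1 of_real_diff)
  finally show ?thesis
    using k lt by (simp add: divide_le_eq a_def)
qed

text \<open>Equality cases of the maximum principle are avoided by applying the strict version to
  \<open>r h\<close> and letting \<open>r\<close> tend to \<open>1\<close>.\<close>

lemma schwarz_pick_at_0:
  assumes holo: "h holomorphic_on ball 0 1"
    and bound: "\<And>z. norm z < 1 \<Longrightarrow> norm (h z) \<le> 1"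
  shows "norm (deriv h 0) \<le> 1 - (norm (h 0))\<^sup>2"
proof -
  have le: "r * norm (deriv h 0) \<le> 1 - (r * norm (h 0))\<^sup>2" if r: "0 < r" "r < 1" for r :: real
  proof -
    have "norm (of_real r * h z) < 1" if "norm z < 1" for z
    proof -
      have "r * norm (h z) \<le> r * 1"
        using bound[OF that] r by (intro mult_left_mono) auto
      also have "\<dots> < 1"
        using r by simp
      finally show ?thesis
        using r by (simp add: norm_mult)
    qed
    moreover have "(\<lambda>z. of_real r * h z) holomorphic_on ball 0 1"
      using holo by (intro holomorphic_intros)
    ultimately have "norm (deriv (\<lambda>z. of_real r * h z) 0) \<le> 1 - (norm (of_real r * h 0))\<^sup>2"
      by (intro schwarz_pick_at_0_strict)
    moreover have "deriv (\<lambda>z. of_real r * h z) 0 = of_real r * deriv h 0"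
      using holo by (intro deriv_cmult) (auto simp: holomorphic_on_imp_differentiable_at)
    ultimately show ?thesis
      using r by (simp add: norm_mult)
  qed
  have "((\<lambda>r. 1 - (r * norm (h 0))\<^sup>2 - r * norm (deriv h 0)) \<longlongrightarrow>
      1 - (1 * norm (h 0))\<^sup>2 - 1 * norm (deriv h 0)) (at_left 1)"
    by (intro tendsto_intros)
  moreover have "eventually (\<lambda>r::real. 0 \<le> 1 - (r * norm (h 0))\<^sup>2 - r * norm (deriv h 0)) (at_left 1)"
    by (rule eventually_mono[OF eventually_at_left_real[of 0 1]]) (use le in auto)
  ultimately have "0 \<le> 1 - (1 * norm (h 0))\<^sup>2 - 1 * norm (deriv h 0)"
    by (rule tendsto_lowerbound) auto
  thus ?thesis
    by simp
qed

text \<open>The Cayley transform \<open>(p - 1) / (p + 1)\<close> maps the disc into itself and fixes \<open>0\<close>, so it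
  equals \<open>z h(z)\<close> with \<open>\<bar>h\<bar> \<le> 1\<close>. Comparing coefficients in \<open>p (1 - z h) = 1 + z h\<close> gives
  \<open>c\<^sub>1 = 2 h(0)\<close> and \<open>c\<^sub>2 - c\<^sub>1\<^sup>2/2 = 2 h'(0)\<close>, and the inequality is the Schwarz-Pick bound
  for \<open>h'(0)\<close>.\<close>

lemma caratheodory_second_coefficient:
  assumes holo: "p holomorphic_on ball 0 1"
    and exp: "p has_fps_expansion P"
    and P0: "fps_nth P 0 = 1"
    and pos: "\<And>z. norm z < 1 \<Longrightarrow> Re (p z) > 0"
  shows "norm (fps_nth P 2 - (fps_nth P 1)\<^sup>2 / 2) \<le> 2 - (norm (fps_nth P 1))\<^sup>2 / 2"
proof -
  define \<omega> where "\<omega> = (\<lambda>z. (p z - 1) / (p z + 1))"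
  have ne: "p z + 1 \<noteq> 0" if "norm z < 1" for z
    using pos[OF that] by (auto simp: complex_eq_iff)
  have hol\<omega>: "\<omega> holomorphic_on ball 0 1"
    unfolding \<omega>_def using holo ne by (intro holomorphic_intros) auto
  have "p 0 = 1"
    using has_fps_expansion_imp_0_eq_fps_nth_0[OF exp] P0 by simp
  hence \<omega>0: "\<omega> 0 = 0"
    by (simp add: \<omega>_def)
  have \<omega>_lt: "norm (\<omega> z) < 1" if "norm z < 1" for z
  proof -
    have "(norm (p z - 1))\<^sup>2 < (norm (p z + 1))\<^sup>2"
      using pos[OF that] unfolding cmod_power2 by (simp add: power2_eq_square algebra_simps)
    hence "norm (p z - 1) < norm (p z + 1)"
      by (rule power2_less_imp_less) auto
    thus ?thesis
      using ne[OF that] by (simp add: \<omega>_def norm_divide)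
  qed
  obtain h where holh: "h holomorphic_on ball 0 1"
    and h: "\<And>z. norm z < 1 \<Longrightarrow> \<omega> z = z * h z" and h0: "deriv \<omega> 0 = h 0"
    using Schwarz3[OF hol\<omega> \<omega>0] by blast
  have "norm (h z) \<le> 1" if z: "norm z < 1" for z
  proof (cases "z = 0")
    case True
    thus ?thesis
      using Schwarz_Lemma(2)[OF hol\<omega> \<omega>0 \<omega>_lt, of 0] h0 by simp
  next
    case False
    thus ?thesis
      using Schwarz_Lemma(1)[OF hol\<omega> \<omega>0 \<omega>_lt z] h[OF z] by (simp add: norm_mult)
  qed
  hence sp: "norm (deriv h 0) \<le> 1 - (norm (h 0))\<^sup>2"
    by (intro schwarz_pick_at_0 holh)
  define H where "H = fps_expansion h 0"
  have H: "h has_fps_expansion H"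
    unfolding H_def using holh by (intro has_fps_expansion_fps_expansion[of "ball 0 1"]) auto
  have H01: "fps_nth H 0 = h 0" "fps_nth H 1 = deriv h 0"
    by (simp_all add: H_def fps_expansion_def)
  have "(\<lambda>z. p z * (1 - z * h z)) has_fps_expansion P * (1 - fps_X * H)"
    by (intro fps_expansion_intros exp H)
  moreover have "eventually (\<lambda>z. p z * (1 - z * h z) = 1 + z * h z) (nhds 0)"
  proof (rule eventually_mono)
    show "eventually (\<lambda>z. z \<in> ball 0 1) (nhds (0::complex))"
      by (rule eventually_nhds_in_open) auto
    fix z :: complex assume "z \<in> ball 0 1"
    hence z: "norm z < 1" by simp
    show "p z * (1 - z * h z) = 1 + z * h z"
      using ne[OF z] unfolding h[OF z, symmetric] \<omega>_def by (simp add: field_simps)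
  qed
  ultimately have "(\<lambda>z. 1 + z * h z) has_fps_expansion P * (1 - fps_X * H)"
    by (simp cong: has_fps_expansion_cong)
  moreover have "(\<lambda>z. 1 + z * h z) has_fps_expansion 1 + fps_X * H"
    by (intro fps_expansion_intros H)
  ultimately have eq: "P * (1 - fps_X * H) = 1 + fps_X * H"
    by (rule fps_expansion_unique_complex)
  hence eq': "P = 1 + fps_X * (H + P * H)"
    by (simp add: algebra_simps)
  have P1: "fps_nth P 1 = 2 * h 0"
    by (subst eq') (simp add: P0 H01)
  have "fps_nth P 2 = fps_nth H 1 + (fps_nth P 0 * fps_nth H 1 + fps_nth P 1 * fps_nth H 0)"
    by (subst eq') (simp add: fps_mult_nth numeral_2_eq_2)
  hence P2: "fps_nth P 2 = 2 * deriv h 0 + 2 * (h 0)\<^sup>2"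
    using P1 P0 H01 by (simp add: power2_eq_square)
  have "norm (fps_nth P 2 - (fps_nth P 1)\<^sup>2 / 2) = 2 * norm (deriv h 0)"
    unfolding P1 P2 by (simp add: power2_eq_square norm_mult)
  thus ?thesis
    using sp unfolding P1 by (simp add: norm_mult power_mult_distrib)
qed

section \<open>The correspondence between the class and functions with positive real part\<close>

text \<open>The function \<open>p\<close> is \<open>\<beta> f(z)/z + (1 - \<beta>) f'(z)\<close>; the operator multiplies the
  coefficient of \<open>z\<^sup>n\<^sup>+\<^sup>1\<close> by \<open>\<beta> + (1 - \<beta>)(n + 1) = 1 + n (1 - \<beta>)\<close> and lowers the exponent
  by one.\<close>

lemma class_A_betaD:
  assumes f: "f \<in> class_A_beta \<beta>"
  obtains p P where "p holomorphic_on ball 0 1" "p has_fps_expansion P"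
    "\<And>z. norm z < 1 \<Longrightarrow> Re (p z) > 0" "fps_nth P 0 = 1"
    "\<And>n. fps_nth P n = of_real (1 + of_nat n * (1 - \<beta>)) * a_coeff f (Suc n)"
proof -
  have holf: "f holomorphic_on ball 0 1"
    and pos: "\<And>z. norm z < 1 \<Longrightarrow>
      Re (of_real \<beta> * (if z = 0 then 1 else f z / z) + of_real (1 - \<beta>) * deriv f z) > 0"
    using f by (auto simp: class_A_beta_def class_A_def)
  obtain a where a: "\<And>z. z \<in> unit_disc \<Longrightarrow> (\<lambda>n. a (n + 2) * z ^ (n + 2)) sums (f z - z)"
    using f unfolding class_A_beta_def class_A_def by blast
  have a01: "a_coeff f 0 = 0" "a_coeff f 1 = 1"
    using a_coeff_eq(1,2)[of a f] a by auto
  define F where "F = fps_expansion f 0"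
  have F: "f has_fps_expansion F"
    unfolding F_def using holf by (intro has_fps_expansion_fps_expansion[of "ball 0 1"]) auto
  have F_nth: "fps_nth F n = a_coeff f n" for n
    by (simp add: F_def a_coeff_def)
  have f0: "f 0 = 0"
    using has_fps_expansion_imp_0_eq_fps_nth_0[OF F] by (simp add: F_nth a01)
  obtain g where holg: "g holomorphic_on ball 0 1"
    and g: "\<And>z. norm z < 1 \<Longrightarrow> f z = z * g z" and g0: "deriv f 0 = g 0"
    using Schwarz3[OF holf f0] by blast
  have "g 0 = 1"
    using a01(2) by (simp add: g0[symmetric] a_coeff_def fps_expansion_def)
  define G where "G = fps_expansion g 0"
  have G: "g has_fps_expansion G"
    unfolding G_def using holg by (intro has_fps_expansion_fps_expansion[of "ball 0 1"]) auto
  have "(\<lambda>z. z * g z) has_fps_expansion fps_X * G"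
    by (intro fps_expansion_intros G)
  moreover have "eventually (\<lambda>z. z * g z = f z) (nhds 0)"
    by (rule eventually_mono[OF eventually_nhds_in_open[of "ball 0 1" 0]]) (auto simp: g)
  ultimately have "f has_fps_expansion fps_X * G"
    by (simp cong: has_fps_expansion_cong)
  hence FG: "F = fps_X * G"
    using F fps_expansion_unique_complex by blast
  define p where "p = (\<lambda>z. of_real \<beta> * g z + of_real (1 - \<beta>) * deriv f z)"
  define P where "P = fps_const (of_real \<beta>) * G + fps_const (of_real (1 - \<beta>)) * fps_deriv F"
  have P_nth: "fps_nth P n = of_real (1 + of_nat n * (1 - \<beta>)) * a_coeff f (Suc n)" for n
  proof -
    have "fps_nth G n = a_coeff f (Suc n)"
      using FG by (simp add: F_nth[symmetric])
    thus ?thesis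
      by (simp add: P_def F_nth algebra_simps)
  qed
  show ?thesis
  proof (rule that)
    show "p holomorphic_on ball 0 1"
      unfolding p_def using holf holg by (intro holomorphic_intros) auto
    show "p has_fps_expansion P"
      unfolding p_def P_def by (intro fps_expansion_intros F G)
    show "Re (p z) > 0" if "norm z < 1" for z
      using pos[OF that] g[OF that] \<open>g 0 = 1\<close> by (auto simp: p_def split: if_splits)
    show "fps_nth P 0 = 1"
      using P_nth[of 0] a01 by simp
  qed (rule P_nth)
qed

text \<open>Inverting the operator divides the coefficients of \<open>P\<close> by the numbers
  \<open>1 + n (1 - \<beta>)\<close>. They are at least \<open>1\<close>, so the radius of convergence does not shrink.\<close>

lemma class_A_betaI:
  fixes P :: "complex fps"
  assumes \<beta>: "\<beta> \<le> 1" and P0: "fps_nth P 0 = 1" and rad: "fps_conv_radius P \<ge> 1"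
    and pos: "\<And>z. norm z < 1 \<Longrightarrow> Re (eval_fps P z) > 0"
  obtains f where "f \<in> class_A_beta \<beta>"
    "\<And>n. a_coeff f (Suc n) = fps_nth P n / of_real (1 + of_nat n * (1 - \<beta>))"
proof -
  define w where "w = (\<lambda>n. 1 + of_nat n * (1 - \<beta>))"
  have w: "w n \<ge> 1" for n
    using \<beta> by (simp add: w_def)
  define G where "G = Abs_fps (\<lambda>n. fps_nth P n / of_real (w n))"
  define F where "F = fps_X * G"
  define f where "f = eval_fps F"
  have "norm (fps_nth G n) \<le> norm (fps_nth P n)" for n
    using w[of n] by (simp add: G_def norm_divide divide_le_eq mult_le_cancel_left1)
  hence "root n (norm (fps_nth G n)) \<le> root n (norm (fps_nth P n))" for n
    by (cases "n = 0") auto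
  hence "fps_conv_radius P \<le> fps_conv_radius G"
    unfolding fps_conv_radius_def conv_radius_def
    by (intro ereal_inverse_antimono Limsup_mono le_Limsup always_eventually)
       (auto simp: real_root_ge_zero)
  hence radG: "fps_conv_radius G \<ge> 1"
    using rad by order
  have radF: "fps_conv_radius F \<ge> 1"
    using fps_conv_radius_mult[of fps_X G] radG unfolding F_def by (simp add: min_def)
  have in_rad: "ereal (norm z) < r" if "norm z < 1" "r \<ge> 1" for z :: complex and r
    using that by (metis ereal_less(3) less_le_trans one_ereal_def ereal_less_eq(3) less_ereal.simps(1))
  have F_exp: "f has_fps_expansion F"
    unfolding f_def using in_rad[of 0, OF _ radF]
    by (intro eval_fps_has_fps_expansion) (simp add: zero_ereal_def)
  hence coeff: "a_coeff f n = fps_nth F n" for n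
    by (simp add: a_coeff_def fps_expansion_eqI)
  have F01: "fps_nth F 0 = 0" "fps_nth F 1 = 1"
    by (simp_all add: F_def G_def P0 w_def)
  have "f holomorphic_on ball 0 1"
    unfolding f_def using in_rad radF by (intro holomorphic_intros) auto
  moreover have "(\<lambda>n. fps_nth F (n + 2) * z ^ (n + 2)) sums (f z - z)" if "norm z < 1" for z
  proof -
    have "(\<lambda>n. fps_nth F n * z ^ n) sums f z"
      unfolding f_def by (rule sums_eval_fps) (use in_rad that radF in auto)
    thus ?thesis
      using F01 sums_iff_shift[of "\<lambda>n. fps_nth F n * z ^ n" 2] by (simp add: numeral_2_eq_2)
  qed
  ultimately have "f \<in> class_A"
    unfolding class_A_def by (auto intro!: exI[of _ "fps_nth F"])
  moreover have "Re (of_real \<beta> * (if z = 0 then 1 else f z / z) + of_real (1 - \<beta>) * deriv f z) > 0"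
    if z: "norm z < 1" for z
  proof -
    have f_eq: "f z = z * eval_fps G z"
      unfolding f_def F_def using in_rad[OF z radG] by (subst eval_fps_mult) auto
    have quot: "(if z = 0 then 1 else f z / z) = eval_fps G z"
      using f_eq by (auto simp: eval_fps_at_0 G_def P0 w_def)
    have der: "deriv f z = eval_fps (fps_deriv F) z"
      unfolding f_def using in_rad[OF z radF] by (simp add: DERIV_imp_deriv has_field_derivative_eval_fps)
    have PG: "P = fps_const (of_real \<beta>) * G + fps_const (of_real (1 - \<beta>)) * fps_deriv F"
    proof (rule fps_ext)
      fix n
      have "fps_nth P n = of_real (w n) * fps_nth G n"
        using w[of n] by (simp add: G_def)
      thus "fps_nth P n =
          fps_nth (fps_const (of_real \<beta>) * G + fps_const (of_real (1 - \<beta>)) * fps_deriv F) n"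
        by (cases n) (simp_all add: F_def w_def algebra_simps)
    qed
    have radF': "fps_conv_radius (fps_deriv F) \<ge> 1"
      using fps_conv_radius_deriv[of F] radF by order
    have "eval_fps P z = of_real \<beta> * eval_fps G z + of_real (1 - \<beta>) * eval_fps (fps_deriv F) z"
    proof -
      have "norm z < fps_conv_radius (fps_const (of_real \<beta>) * G)"
        using fps_conv_radius_mult[of "fps_const (of_real \<beta>)" G] radG
        by (intro in_rad[OF z]) (auto simp: min_def split: if_splits)
      moreover have "norm z < fps_conv_radius (fps_const (of_real (1 - \<beta>)) * fps_deriv F)"
        using fps_conv_radius_mult[of "fps_const (of_real (1 - \<beta>))" "fps_deriv F"] radF'
        by (intro in_rad[OF z]) (auto simp: min_def split: if_splits)
      ultimately show ?thesis
        using in_rad[OF z radG] in_rad[OF z radF']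
        by (subst PG) (simp add: eval_fps_add eval_fps_mult)
    qed
    thus ?thesis
      using pos[OF z] unfolding quot der by simp
  qed
  ultimately have "f \<in> class_A_beta \<beta>"
    by (auto simp: class_A_beta_def)
  thus ?thesis
    by (rule that) (simp add: coeff F_def G_def w_def)
qed

lemma Re_inverse_one_minus_gt_half:
  assumes "norm (v::complex) < 1"
  shows "Re (1 / (1 - v)) > 1 / 2"
proof -
  have "v \<noteq> 1"
    using assms by auto
  hence "(norm (1 - v))\<^sup>2 > 0"
    by simp
  moreover have "(norm v)\<^sup>2 < 1"
    using assms by (simp add: power_less_one_iff)
  ultimately show ?thesis
    unfolding cmod_power2 Re_divide by (simp add: field_simps power2_eq_square)
qed

text \<open>The sum is the mean of the half-plane maps \<open>(1 + v) / (1 - v) = 2 / (1 - v) - 1\<close> at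
  \<open>v = e\<^sup>i\<^sup>\<theta> z\<close> and \<open>v = e\<^sup>-\<^sup>i\<^sup>\<theta> z\<close>, each of which has positive real part.\<close>

lemma cosine_series:
  fixes \<theta> :: real
  defines "P \<equiv> Abs_fps (\<lambda>n. if n = 0 then 1 else complex_of_real (2 * cos (of_nat n * \<theta>)))"
  shows "fps_conv_radius P \<ge> 1"
    and "norm z < 1 \<Longrightarrow> Re (eval_fps P z) > 0"
proof -
  have sums: "(\<lambda>n. fps_nth P n * z ^ n) sums (1 / (1 - cis \<theta> * z) + 1 / (1 - cis (-\<theta>) * z) - 1)"
    if "norm z < 1" for z
  proof -
    have "(\<lambda>n. (cis \<theta> * z) ^ n) sums (1 / (1 - cis \<theta> * z))"
      "(\<lambda>n. (cis (-\<theta>) * z) ^ n) sums (1 / (1 - cis (-\<theta>) * z))"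
      using that by (auto intro!: geometric_sums simp: norm_mult)
    moreover have "(\<lambda>n. if n = 0 then 1 else 0 :: complex) sums 1"
      using sums_single[of 0 "\<lambda>_. 1 :: complex"] by simp
    ultimately have "(\<lambda>n. (cis \<theta> * z) ^ n + (cis (-\<theta>) * z) ^ n - (if n = 0 then 1 else 0)) sums
        (1 / (1 - cis \<theta> * z) + 1 / (1 - cis (-\<theta>) * z) - 1)"
      by (intro sums_add sums_diff)
    moreover have "(cis \<theta> * z) ^ n + (cis (-\<theta>) * z) ^ n - (if n = 0 then 1 else 0)
        = fps_nth P n * z ^ n" for n
    proof -
      have "cis (of_nat n * \<theta>) + cis (- (of_nat n * \<theta>)) = of_real (2 * cos (of_nat n * \<theta>))"
        by (simp add: complex_eq_iff)
      thus ?thesis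
        by (simp add: P_def power_mult_distrib Complex.DeMoivre flip: distrib_right)
    qed
    ultimately show ?thesis
      by simp
  qed
  show "fps_conv_radius P \<ge> 1"
    unfolding fps_conv_radius_def
  proof (rule conv_radius_geI_ex)
    fix r :: real assume "0 < r" "ereal r < 1"
    thus "\<exists>z. norm z = r \<and> summable (\<lambda>n. fps_nth P n * z ^ n)"
      using sums[of "of_real r"] by (intro exI[of _ "of_real r"]) (auto simp: sums_iff)
  qed
  assume z: "norm z < 1"
  have "eval_fps P z = 1 / (1 - cis \<theta> * z) + 1 / (1 - cis (-\<theta>) * z) - 1"
    using sums[OF z] by (simp add: eval_fps_def sums_iff)
  moreover have "Re (1 / (1 - cis \<theta> * z)) > 1 / 2" "Re (1 / (1 - cis (-\<theta>) * z)) > 1 / 2"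
    using z by (intro Re_inverse_one_minus_gt_half; simp add: norm_mult)+
  ultimately show "Re (eval_fps P z) > 0"
    by simp
qed

section \<open>The extremal problem for the coefficients\<close>

lemma T31_complete_square:
  "T31 f = (1 - (norm (a_coeff f 2))\<^sup>2)\<^sup>2 - (norm (a_coeff f 3 - (a_coeff f 2)\<^sup>2))\<^sup>2"
  unfolding T31_eq cmod_power2 by (simp add: power2_eq_square algebra_simps)

text \<open>The value at the vertex is \<open>-(2 - u\<^sup>2)\<^sup>2 / D\<close>, and \<open>(2 - u\<^sup>2)\<^sup>2 = 5 + 4 u - D\<close>.\<close>

lemma quadratic_min:
  fixes u X :: real
  assumes "0 \<le> u" "u \<le> 1"
  defines "D \<equiv> (1 + 2 * u)\<^sup>2 - u ^ 4"
  shows "D > 0"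
    and "(1 - X)\<^sup>2 - ((2 - u\<^sup>2 * X) / (1 + 2 * u))\<^sup>2
      = D / (1 + 2 * u)\<^sup>2 * (X - (1 + 4 * u + 2 * u\<^sup>2) / D)\<^sup>2 + (1 - (5 + 4 * u) / D)"
proof -
  have "u ^ 4 \<le> u"
    using assms power_decreasing[of 1 4 u] by simp
  moreover have "D = 1 + 4 * u + 4 * u\<^sup>2 - u ^ 4"
    by (simp add: D_def power2_eq_square algebra_simps)
  ultimately show D: "D > 0"
    using assms zero_le_power2[of u] by linarith
  have B: "1 + 2 * u \<noteq> 0"
    using assms by linarith
  \<comment> \<open>Clearing denominators reduces the identity to one between polynomials in \<open>u\<close> and \<open>X\<close>.\<close>
  have gen: "D\<^sup>2 * B\<^sup>2 * (D / B\<^sup>2 * (X - M / D)\<^sup>2 + (1 - N / D))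
      = D * ((D * X - M)\<^sup>2 + B\<^sup>2 * (D - N))"
    if "B \<noteq> 0" for B M N :: real
  proof -
    have "D * X - M = D * (X - M / D)" "D - N = D * (1 - N / D)"
      using D by (simp_all add: right_diff_distrib)
    thus ?thesis
      using that by (simp add: power2_eq_square distrib_left)
  qed
  have "D\<^sup>2 * (1 + 2 * u)\<^sup>2 * ((1 - X)\<^sup>2 - ((2 - u\<^sup>2 * X) / (1 + 2 * u))\<^sup>2)
      = D\<^sup>2 * ((1 + 2 * u)\<^sup>2 * (1 - X)\<^sup>2 - (2 - u\<^sup>2 * X)\<^sup>2)"
    using B by (simp add: power_divide right_diff_distrib)
  also have "\<dots> = D * ((D * X - (1 + 4 * u + 2 * u\<^sup>2))\<^sup>2 + (1 + 2 * u)\<^sup>2 * (D - (5 + 4 * u)))"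
    unfolding D_def by algebra
  also have "\<dots> = D\<^sup>2 * (1 + 2 * u)\<^sup>2 *
      (D / (1 + 2 * u)\<^sup>2 * (X - (1 + 4 * u + 2 * u\<^sup>2) / D)\<^sup>2 + (1 - (5 + 4 * u) / D))"
    using gen[OF B] by simp
  finally show "(1 - X)\<^sup>2 - ((2 - u\<^sup>2 * X) / (1 + 2 * u))\<^sup>2
      = D / (1 + 2 * u)\<^sup>2 * (X - (1 + 4 * u + 2 * u\<^sup>2) / D)\<^sup>2 + (1 - (5 + 4 * u) / D)"
    using B D by simp
qed

text \<open>The difference splits as
  \<open>(1 + 2 u) (a\<^sub>3 - a\<^sub>2\<^sup>2) = (c\<^sub>2 - c\<^sub>1\<^sup>2/2) - (1 + 2 u - u\<^sup>2)/2 a\<^sub>2\<^sup>2\<close>. The two terms are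
  bounded by \<open>2 - (1 + u)\<^sup>2/2 \<bar>a\<^sub>2\<bar>\<^sup>2\<close> and \<open>(1 + 2 u - u\<^sup>2)/2 \<bar>a\<^sub>2\<bar>\<^sup>2\<close>, whose sum is
  \<open>2 - u\<^sup>2 \<bar>a\<^sub>2\<bar>\<^sup>2\<close>.\<close>

lemma norm_a3_minus_a2_square_le:
  fixes c\<^sub>1 c\<^sub>2 :: complex and u :: real
  assumes u: "0 \<le> u" "u \<le> 1"
    and c: "norm (c\<^sub>2 - c\<^sub>1\<^sup>2 / 2) \<le> 2 - (norm c\<^sub>1)\<^sup>2 / 2"
    and a2: "c\<^sub>1 = of_real (1 + u) * a\<^sub>2" and a3: "c\<^sub>2 = of_real (1 + 2 * u) * a\<^sub>3"
  shows "norm (a\<^sub>3 - a\<^sub>2\<^sup>2) \<le> (2 - u\<^sup>2 * (norm a\<^sub>2)\<^sup>2) / (1 + 2 * u)"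
proof -
  define X where "X = (norm a\<^sub>2)\<^sup>2"
  have k: "1 + 2 * u - u\<^sup>2 \<ge> 0"
    using u power_le_one[of u 2] by linarith
  have "of_real (1 + 2 * u) * (a\<^sub>3 - a\<^sub>2\<^sup>2)
      = (c\<^sub>2 - c\<^sub>1\<^sup>2 / 2) - of_real ((1 + 2 * u - u\<^sup>2) / 2) * a\<^sub>2\<^sup>2"
    unfolding a2 a3 by (simp add: field_simps power2_eq_square)
  hence "(1 + 2 * u) * norm (a\<^sub>3 - a\<^sub>2\<^sup>2)
      = norm ((c\<^sub>2 - c\<^sub>1\<^sup>2 / 2) - of_real ((1 + 2 * u - u\<^sup>2) / 2) * a\<^sub>2\<^sup>2)"
    using u norm_mult[of "of_real (1 + 2 * u)" "a\<^sub>3 - a\<^sub>2\<^sup>2"] 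
    by (metis abs_of_nonneg add_nonneg_nonneg mult_nonneg_nonneg norm_of_real zero_le_numeral zero_le_one)
  also have "\<dots> \<le> norm (c\<^sub>2 - c\<^sub>1\<^sup>2 / 2) + norm (of_real ((1 + 2 * u - u\<^sup>2) / 2) * a\<^sub>2\<^sup>2)"
    by (rule norm_triangle_ineq4)
  also have "norm (of_real ((1 + 2 * u - u\<^sup>2) / 2) * a\<^sub>2\<^sup>2) = (1 + 2 * u - u\<^sup>2) / 2 * X"
    using k unfolding X_def norm_mult norm_power norm_of_real by simp
  also have "norm (c\<^sub>2 - c\<^sub>1\<^sup>2 / 2) \<le> 2 - (1 + u)\<^sup>2 * X / 2"
    using c u unfolding a2 X_def norm_mult norm_of_real by (simp add: power_mult_distrib)
  also have "2 - (1 + u)\<^sup>2 * X / 2 + (1 + 2 * u - u\<^sup>2) / 2 * X = 2 - u\<^sup>2 * X"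
    by (simp add: field_simps power2_eq_square)
  finally show ?thesis
    using u by (simp add: X_def field_simps)
qed

theorem theorem3p3:
  fixes \<beta> :: real
  assumes "0 \<le> \<beta>" and "\<beta> \<le> 1"
  shows "(\<forall>f \<in> class_A_beta \<beta>.
            T31 f \<ge> 1 - (4 * \<beta> - 9) / (\<beta>^4 - 4 * \<beta>^3 + 2 * \<beta>^2 + 8 * \<beta> - 8))
       \<and> (\<exists>f \<in> class_A_beta \<beta>.
            T31 f = 1 - (4 * \<beta> - 9) / (\<beta>^4 - 4 * \<beta>^3 + 2 * \<beta>^2 + 8 * \<beta> - 8))"
proof -
  define u where "u = 1 - \<beta>"
  define D where "D = (1 + 2 * u)\<^sup>2 - u ^ 4"
  define x where "x = (1 + 4 * u + 2 * u\<^sup>2) / D"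
  have u: "0 \<le> u" "u \<le> 1"
    using assms by (auto simp: u_def)
  have D: "D > 0"
    using quadratic_min(1)[OF u] by (simp add: D_def)
  have min: "(1 - X)\<^sup>2 - ((2 - u\<^sup>2 * X) / (1 + 2 * u))\<^sup>2
      = D / (1 + 2 * u)\<^sup>2 * (X - x)\<^sup>2 + (1 - (5 + 4 * u) / D)" for X
    using quadratic_min(2)[OF u] by (simp add: D_def x_def)
  have "\<beta>^4 - 4 * \<beta>^3 + 2 * \<beta>^2 + 8 * \<beta> - 8 = - D"
    unfolding D_def u_def by algebra
  moreover have "4 * \<beta> - 9 = - (5 + 4 * u)"
    by (simp add: u_def)
  ultimately have value_eq:
    "1 - (4 * \<beta> - 9) / (\<beta>^4 - 4 * \<beta>^3 + 2 * \<beta>^2 + 8 * \<beta> - 8) = 1 - (5 + 4 * u) / D"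
    by (simp only: minus_divide_divide)
  have "T31 f \<ge> 1 - (5 + 4 * u) / D" if f: "f \<in> class_A_beta \<beta>" for f
  proof -
    obtain p P where p: "p holomorphic_on ball 0 1" "p has_fps_expansion P"
      "\<And>z. norm z < 1 \<Longrightarrow> Re (p z) > 0" "fps_nth P 0 = 1"
      and P: "\<And>n. fps_nth P n = of_real (1 + of_nat n * (1 - \<beta>)) * a_coeff f (Suc n)"
      using class_A_betaD[OF f] by blast
    have P12: "fps_nth P 1 = of_real (1 + u) * a_coeff f 2"
      "fps_nth P 2 = of_real (1 + 2 * u) * a_coeff f 3"
      using P[of 1] P[of 2] by (simp_all add: u_def numeral_2_eq_2 numeral_3_eq_3)
    define X where "X = (norm (a_coeff f 2))\<^sup>2"
    have "norm (a_coeff f 3 - (a_coeff f 2)\<^sup>2) \<le> (2 - u\<^sup>2 * X) / (1 + 2 * u)"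
      unfolding X_def
      using norm_a3_minus_a2_square_le[OF u caratheodory_second_coefficient[OF p(1,2,4,3)] P12] .
    hence "(norm (a_coeff f 3 - (a_coeff f 2)\<^sup>2))\<^sup>2 \<le> ((2 - u\<^sup>2 * X) / (1 + 2 * u))\<^sup>2"
      by (intro power_mono) auto
    hence "T31 f \<ge> (1 - X)\<^sup>2 - ((2 - u\<^sup>2 * X) / (1 + 2 * u))\<^sup>2"
      by (simp add: T31_complete_square X_def)
    moreover have "D / (1 + 2 * u)\<^sup>2 * (X - x)\<^sup>2 \<ge> 0"
      using D by simp
    ultimately show ?thesis
      using min[of X] by linarith
  qed
  moreover have "\<exists>f \<in> class_A_beta \<beta>. T31 f = 1 - (5 + 4 * u) / D"
  proof -
    \<comment> \<open>The value of \<open>cos \<theta>\<close> for which \<open>a\<^sub>2 = 2 cos \<theta> / (1 + u)\<close> equals \<open>\<surd>x\<close>.\<close>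
    define c where "c = (1 + u) * sqrt x / 2"
    have x0: "x \<ge> 0"
      using u D by (simp add: x_def)
    \<comment> \<open>Cancelling the common factor of \<open>D\<close> turns \<open>c \<le> 1\<close> into
      \<open>6 u\<^sup>2 \<le> 3 + 4 u\<close>, which holds on \<open>[0, 1]\<close>.\<close>
    have "D = (1 + 2 * u - u\<^sup>2) * (1 + u)\<^sup>2"
      unfolding D_def by algebra
    hence "(1 + 2 * u - u\<^sup>2) * ((1 + u)\<^sup>2 * x) = D * x"
      by simp
    also have "\<dots> = 1 + 4 * u + 2 * u\<^sup>2"
      using D by (simp add: x_def)
    finally have "(1 + 2 * u - u\<^sup>2) * ((1 + u)\<^sup>2 * x) = 1 + 4 * u + 2 * u\<^sup>2" .
    moreover have k: "u\<^sup>2 \<le> u" "u\<^sup>2 \<le> 1"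
      using u by (auto simp: power2_eq_square mult_left_le mult_le_one)
    moreover have "1 + 4 * u + 2 * u\<^sup>2 \<le> (1 + 2 * u - u\<^sup>2) * 4"
      using k u by (simp add: left_diff_distrib distrib_right)
    moreover have "1 + 2 * u - u\<^sup>2 > 0"
      using k u by linarith
    ultimately have "(1 + u)\<^sup>2 * x \<le> 4"
      by (metis mult_le_cancel_left_pos)
    hence c2: "c\<^sup>2 = (1 + u)\<^sup>2 * x / 4" and "c\<^sup>2 \<le> 1"
      using x0 by (auto simp: c_def power_mult_distrib power_divide)
    moreover have "c \<ge> 0"
      using u x0 by (simp add: c_def)
    ultimately have cos: "cos (arccos c) = c"
      by (intro cos_arccos) (auto simp: abs_square_le_1)
    define P where
      "P = Abs_fps (\<lambda>n. if n = 0 then 1 else complex_of_real (2 * cos (of_nat n * arccos c)))"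
    have P: "fps_nth P 0 = 1" "fps_conv_radius P \<ge> 1"
      "\<And>z. norm z < 1 \<Longrightarrow> Re (eval_fps P z) > 0"
      using cosine_series[where \<theta> = "arccos c"] by (simp_all add: P_def)
    obtain f where f: "f \<in> class_A_beta \<beta>"
      and coeff: "\<And>n. a_coeff f (Suc n) = fps_nth P n / of_real (1 + of_nat n * (1 - \<beta>))"
      using class_A_betaI[OF assms(2) P] by blast
    have "a_coeff f 2 = of_real (2 * c / (1 + u))"
      using coeff[of 1] cos by (simp add: P_def u_def numeral_2_eq_2)
    also have "2 * c / (1 + u) = sqrt x"
      using u by (simp add: c_def)
    finally have a2: "a_coeff f 2 = of_real (sqrt x)" .
    have "a_coeff f 3 = of_real (2 * cos (2 * arccos c) / (1 + 2 * u))"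
      using coeff[of 2] by (simp add: P_def u_def numeral_3_eq_3 numeral_2_eq_2)
    also have "2 * cos (2 * arccos c) = (1 + u)\<^sup>2 * x - 2"
      using cos c2 by (simp add: cos_double_cos)
    finally have a3: "a_coeff f 3 = of_real (((1 + u)\<^sup>2 * x - 2) / (1 + 2 * u))" .
    have "((1 + u)\<^sup>2 * x - 2) / (1 + 2 * u) - x = - ((2 - u\<^sup>2 * x) / (1 + 2 * u))"
      using u by (simp add: field_simps power2_eq_square)
    hence "a_coeff f 3 - (a_coeff f 2)\<^sup>2 = of_real (- ((2 - u\<^sup>2 * x) / (1 + 2 * u)))"
      using x0 unfolding a2 a3 by (metis of_real_diff of_real_power real_sqrt_pow2)
    hence "(norm (a_coeff f 3 - (a_coeff f 2)\<^sup>2))\<^sup>2 = ((2 - u\<^sup>2 * x) / (1 + 2 * u))\<^sup>2"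
      by (simp only: norm_of_real power2_abs power2_minus)
    moreover have "(norm (a_coeff f 2))\<^sup>2 = x"
      using x0 by (simp add: a2)
    ultimately have "T31 f = (1 - x)\<^sup>2 - ((2 - u\<^sup>2 * x) / (1 + 2 * u))\<^sup>2"
      by (simp only: T31_complete_square)
    also have "\<dots> = 1 - (5 + 4 * u) / D"
      unfolding min by simp
    finally show ?thesis
      using f by blast
  qed
  ultimately show ?thesis
    unfolding value_eq by blast
qed

end
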